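(* Let $(\mathscr L,\leqslant)$ be a bounded poset with least element $\perp$ and greatest element $\top$, let $(S,\leqslant)$ be a complete lattice, and let $\mu:P_{<}(\mathscr L)\to S$ be a map. Assume that the following conditions are satisfied: (i) For any ascending chain $x_0<x_1<\ldots<x_n<x_{n+1}<\ldots$ of elements of $\mathscr L$, there exists $N\in\mathbb N$ such that $\mu(x_N,x_{N+1})\leqslant\mu(x_{N},\top)$. (ii) For any descending chain $x_0>x_1>\ldots>x_n>x_{n+1}>\ldots$ of elements of $\mathscr L$, there exists $N\in\mathbb N$ such that $\mu(\perp,x_N)\leqslant\mu(x_{N+1},x_N)$. (iii) The complete lattice $(S,\leqslant)$ is totally ordered, and $\mu$ is slope-like, i.e., for all $x<y<z$ in $\mathscr L$, one has $\mu(x,y)<\mu(x,z)<\mu(y,z)$, or $\mu(x,y)>\mu(x,z)>\mu(y,z)$, or $\mu(x,y)=\mu(x,z)=\mu(y,z)$. Then the following statements are equivalent: (a) $\mu_{\max}(\top)=\mu(\perp,\top)$. (b) $\mu_{\min}(\top)=\mu(\perp,\top)$. (c) $\mu_{\min}(\top)=\mu_{\max}(\top)$. (d) The Harder-Narasimhan game with pay-off function $\mu$ has Nash equilibrium. (e) The Harder-Narasimhan game with pay-off function $\mu$ is semi-stable.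
   Context: A bounded poset is a partially ordered set with a least element $\perp$ and a greatest element $\top$, $\perp\neq\top$. $P_{<}(\mathscr L)=\{(x,y)\in\mathscr L^2\,|\,x<y\}$. A complete lattice is a partially ordered set in which every subset has a supremum and an infimum. Chains in (i), (ii) are indexed by $\mathbb N$. Put \[\mu_{\max}(\top):=\sup_{x\in\mathscr L\setminus\{\perp\}}\mu(\perp,x),\qquad \mu_{\min}(\top):=\inf_{x\in\mathscr L\setminus\{\top\}}\mu(x,\top),\] \[\mu_A^*:=\inf_{x\in\mathscr L\setminus\{\top\}}\;\sup_{y\in\mathscr L,\;x<y}\mu(x,y),\qquad \mu_B^*:=\sup_{y\in\mathscr L\setminus\{\perp\}}\;\inf_{x\in\mathscr L,\;x<y}\mu(x,y).\] The Harder-Narasimhan game with pay-off function $\mu$ has Nash equilibrium if $\mu_A^*=\mu_B^*$. For $y\in\mathscr L\setminus\{\perp\}$, put \[\mu_A(y):=\inf_{a\in\mathscr L,\;a<y}\;\sup_{b\in\mathscr L,\;a<b\leqslant y}\mu(a,b).\] The Harder-Narasimhan game with pay-off function $\mu$ is semi-stable if for any $y\in\mathscr L\setminus\{\perp\}$ one has $\mu_A(y)\not>\mu_A(\top)$. *)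

theory Defs
  imports Main
begin

text \<open>
  The bounded poset is a type of sort \<open>{order_bot, order_top}\<close>, whose least and greatest elements
  \<open>bot\<close> and \<open>top\<close> are assumed to be distinct where this matters. A pay-off function on the set of
  pairs \<open>x < y\<close> is represented by a total curried function; every definition below only uses its
  values \<open>\<mu> x y\<close> with \<open>x < y\<close>.
\<close>

definition mu_max_top :: "('a::{order_bot, order_top} \<Rightarrow> 'a \<Rightarrow> 's::complete_lattice) \<Rightarrow> 's" where
  "mu_max_top \<mu> = (SUP x \<in> UNIV - {bot}. \<mu> bot x)"

definition mu_min_top :: "('a::{order_bot, order_top} \<Rightarrow> 'a \<Rightarrow> 's::complete_lattice) \<Rightarrow> 's" where
  "mu_min_top \<mu> = (INF x \<in> UNIV - {top}. \<mu> x top)"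

definition mu_A_star :: "('a::{order_bot, order_top} \<Rightarrow> 'a \<Rightarrow> 's::complete_lattice) \<Rightarrow> 's" where
  "mu_A_star \<mu> = (INF x \<in> UNIV - {top}. SUP y \<in> {y. x < y}. \<mu> x y)"

definition mu_B_star :: "('a::{order_bot, order_top} \<Rightarrow> 'a \<Rightarrow> 's::complete_lattice) \<Rightarrow> 's" where
  "mu_B_star \<mu> = (SUP y \<in> UNIV - {bot}. INF x \<in> {x. x < y}. \<mu> x y)"

definition nash_equilibrium ::
    "('a::{order_bot, order_top} \<Rightarrow> 'a \<Rightarrow> 's::complete_lattice) \<Rightarrow> bool" where
  "nash_equilibrium \<mu> \<longleftrightarrow> mu_A_star \<mu> = mu_B_star \<mu>"

definition mu_A :: "('a::{order_bot, order_top} \<Rightarrow> 'a \<Rightarrow> 's::complete_lattice) \<Rightarrow> 'a \<Rightarrow> 's" where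
  "mu_A \<mu> y = (INF a \<in> {a. a < y}. SUP b \<in> {b. a < b \<and> b \<le> y}. \<mu> a b)"

definition semi_stable ::
    "('a::{order_bot, order_top} \<Rightarrow> 'a \<Rightarrow> 's::complete_lattice) \<Rightarrow> bool" where
  "semi_stable \<mu> \<longleftrightarrow> (\<forall>y \<in> UNIV - {bot}. \<not> mu_A \<mu> y > mu_A \<mu> top)"

definition slope_like :: "('a::order \<Rightarrow> 'a \<Rightarrow> 's::order) \<Rightarrow> bool" where
  "slope_like \<mu> \<longleftrightarrow> (\<forall>x y z. x < y \<and> y < z \<longrightarrow>
      (\<mu> x y < \<mu> x z \<and> \<mu> x z < \<mu> y z) \<or>
      (\<mu> x y > \<mu> x z \<and> \<mu> x z > \<mu> y z) \<or>
      (\<mu> x y = \<mu> x z \<and> \<mu> x z = \<mu> y z))"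

end

theory Submission
  imports Defs
begin

text \<open>
  The chain conditions forbid moving upwards (downwards) forever along pairs that violate
  \<open>\<mu> x y \<le> \<mu> x top\<close> (\<open>\<mu> bot y \<le> \<mu> x y\<close>), while by the slope inequalities each such move
  decreases \<open>\<mu> _ top\<close> (increases \<open>\<mu> bot _\<close>). The points where the process stops show that the
  game value \<open>mu_A_star\<close> equals \<open>mu_min_top\<close> and that \<open>mu_B_star\<close> equals \<open>mu_max_top\<close>; the lower
  stopping points are also the ones on which semi-stability is tested.
\<close>

lemma slope_like_le_iff:
  assumes "slope_like \<mu>" "x < y" "y < z"
  shows "\<mu> x y \<le> \<mu> x z \<longleftrightarrow> \<mu> x z \<le> \<mu> y z"
  using assms unfolding slope_like_def by (metis less_le_not_le order_refl)

lemma slope_like_less_iff: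
  assumes "slope_like \<mu>" "x < y" "y < z"
  shows "\<mu> x z < \<mu> x y \<longleftrightarrow> \<mu> y z < \<mu> x z"
  using assms unfolding slope_like_def by (metis less_le_not_le order_refl)

text \<open>As long as some \<open>y\<close> above \<open>x\<close> gives \<open>\<mu> x y\<close>
  greater than \<open>\<mu> x top\<close>, the point \<open>x\<close> can be replaced by
  \<open>y\<close>; \<open>asc\<close> makes this terminate.\<close>

lemma exists_above_maximizing_at_top:
  fixes \<mu> :: "'a::{order_bot, order_top} \<Rightarrow> 'a \<Rightarrow> 's::complete_lattice"
  assumes asc: "\<And>x :: nat \<Rightarrow> 'a. (\<And>n. x n < x (Suc n)) \<Longrightarrow>
        \<exists>N. \<mu> (x N) (x (Suc N)) \<le> \<mu> (x N) top"
    and total: "\<And>s t :: 's. s \<le> t \<or> t \<le> s"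
    and slope: "slope_like \<mu>"
    and "x \<noteq> top"
  obtains x' where "x' \<noteq> top" "\<mu> x' top \<le> \<mu> x top" "\<And>y. x' < y \<Longrightarrow> \<mu> x' y \<le> \<mu> x' top"
proof -
  \<comment> \<open>The larger element comes first in each pair, so an infinite descent along
    \<open>?r\<close> is a strictly ascending sequence that violates \<open>asc\<close> at every
    index.\<close>
  let ?r = "{(y, x). x < y \<and> \<mu> x top < \<mu> x y}"
  have "wf ?r"
    unfolding wf_iff_no_infinite_down_chain using asc by (fastforce dest: less_le_not_le[THEN iffD1])
  then have "x \<noteq> top \<longrightarrow>
    (\<exists>x'. x' \<noteq> top \<and> \<mu> x' top \<le> \<mu> x top \<and> (\<forall>y. x' < y \<longrightarrow> \<mu> x' y \<le> \<mu> x' top))"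
  proof (induction x rule: wf_induct_rule)
    case (less x)
    show ?case
    proof (cases "\<forall>y. x < y \<longrightarrow> \<mu> x y \<le> \<mu> x top")
      case False
      then obtain y where y: "x < y" "\<mu> x top < \<mu> x y"
        using total less_le_not_le by blast
      \<comment> \<open>For \<open>y = top\<close> the strict inequality would compare
        \<open>\<mu> x top\<close> with itself; hence the slope condition applies to
        \<open>x < y < top\<close>.\<close>
      then have "y \<noteq> top" by auto
      then have "\<mu> y top < \<mu> x top"
        using slope_like_less_iff[OF slope \<open>x < y\<close>, of top] y top.not_eq_extremum by blast
      then show ?thesis
        using less.IH[of y] y \<open>y \<noteq> top\<close> by (auto intro: order_trans[OF _ less_imp_le])
    qed auto
  qed
  then show thesis using \<open>x \<noteq> top\<close> that by blast
qed

text \<open>Order-dual of the preceding argument: one descends through \<open>x < y\<close> with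
  \<open>\<mu> x y < \<mu> bot y\<close>, and the slope condition on \<open>bot < x < y\<close>
  makes \<open>\<mu> bot _\<close> grow.\<close>

lemma exists_below_minimizing_at_bot:
  fixes \<mu> :: "'a::{order_bot, order_top} \<Rightarrow> 'a \<Rightarrow> 's::complete_lattice"
  assumes desc: "\<And>x :: nat \<Rightarrow> 'a. (\<And>n. x n > x (Suc n)) \<Longrightarrow>
        \<exists>N. \<mu> bot (x N) \<le> \<mu> (x (Suc N)) (x N)"
    and total: "\<And>s t :: 's. s \<le> t \<or> t \<le> s"
    and slope: "slope_like \<mu>"
    and "y \<noteq> bot"
  obtains y' where "y' \<noteq> bot" "\<mu> bot y \<le> \<mu> bot y'" "\<And>x. x < y' \<Longrightarrow> \<mu> bot y' \<le> \<mu> x y'"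
proof -
  let ?r = "{(x, y). x < y \<and> \<mu> x y < \<mu> bot y}"
  have "wf ?r"
    unfolding wf_iff_no_infinite_down_chain using desc by (fastforce dest: less_le_not_le[THEN iffD1])
  then have "y \<noteq> bot \<longrightarrow>
    (\<exists>y'. y' \<noteq> bot \<and> \<mu> bot y \<le> \<mu> bot y' \<and> (\<forall>x. x < y' \<longrightarrow> \<mu> bot y' \<le> \<mu> x y'))"
  proof (induction y rule: wf_induct_rule)
    case (less y)
    show ?case
    proof (cases "\<forall>x. x < y \<longrightarrow> \<mu> bot y \<le> \<mu> x y")
      case False
      then obtain x where x: "x < y" "\<mu> x y < \<mu> bot y"
        using total less_le_not_le by blast
      then have "x \<noteq> bot" by auto
      then have "\<mu> bot y < \<mu> bot x"
        using slope_like_less_iff[OF slope _ \<open>x < y\<close>, of bot] x bot.not_eq_extremum by blast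
      then show ?thesis
        using less.IH[of x] x \<open>x \<noteq> bot\<close> by (auto intro: order_trans[OF less_imp_le])
    qed auto
  qed
  then show thesis using \<open>y \<noteq> bot\<close> that by blast
qed

lemma mu_A_star_eq_mu_min_top:
  fixes \<mu> :: "'a::{order_bot, order_top} \<Rightarrow> 'a \<Rightarrow> 's::complete_lattice"
  assumes asc: "\<And>x :: nat \<Rightarrow> 'a. (\<And>n. x n < x (Suc n)) \<Longrightarrow>
        \<exists>N. \<mu> (x N) (x (Suc N)) \<le> \<mu> (x N) top"
    and total: "\<And>s t :: 's. s \<le> t \<or> t \<le> s"
    and slope: "slope_like \<mu>"
  shows "mu_A_star \<mu> = mu_min_top \<mu>"
proof (rule order.antisym)
  show "mu_A_star \<mu> \<le> mu_min_top \<mu>"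
    unfolding mu_A_star_def mu_min_top_def
  proof (rule INF_mono)
    fix x :: 'a assume "x \<in> UNIV - {top}"
    then obtain x' where "x' \<noteq> top" "\<mu> x' top \<le> \<mu> x top" "\<And>y. x' < y \<Longrightarrow> \<mu> x' y \<le> \<mu> x' top"
      using exists_above_maximizing_at_top[OF asc total slope] by blast
    then show "\<exists>x'\<in>UNIV - {top}. (SUP y\<in>{y. x' < y}. \<mu> x' y) \<le> \<mu> x top"
      \<comment> \<open>Every \<open>\<mu> x' y\<close> in the supremum is bounded by
        \<open>\<mu> x' top\<close>, hence by \<open>\<mu> x top\<close>.\<close>
      by (intro bexI[of _ x'] SUP_least) (auto intro: order_trans)
  qed
  show "mu_min_top \<mu> \<le> mu_A_star \<mu>"
    unfolding mu_A_star_def mu_min_top_def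
    \<comment> \<open>For the same \<open>x\<close>, the choice \<open>y = top\<close> is admissible
      in the supremum.\<close>
    by (rule INF_mono) (auto simp: top.not_eq_extremum intro!: bexI SUP_upper)
qed

lemma mu_B_star_eq_mu_max_top:
  fixes \<mu> :: "'a::{order_bot, order_top} \<Rightarrow> 'a \<Rightarrow> 's::complete_lattice"
  assumes desc: "\<And>x :: nat \<Rightarrow> 'a. (\<And>n. x n > x (Suc n)) \<Longrightarrow>
        \<exists>N. \<mu> bot (x N) \<le> \<mu> (x (Suc N)) (x N)"
    and total: "\<And>s t :: 's. s \<le> t \<or> t \<le> s"
    and slope: "slope_like \<mu>"
  shows "mu_B_star \<mu> = mu_max_top \<mu>"
proof (rule order.antisym)
  show "mu_max_top \<mu> \<le> mu_B_star \<mu>"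
    unfolding mu_B_star_def mu_max_top_def
  proof (rule SUP_mono)
    fix y :: 'a assume "y \<in> UNIV - {bot}"
    then obtain y' where "y' \<noteq> bot" "\<mu> bot y \<le> \<mu> bot y'" "\<And>x. x < y' \<Longrightarrow> \<mu> bot y' \<le> \<mu> x y'"
      using exists_below_minimizing_at_bot[OF desc total slope] by blast
    then show "\<exists>y'\<in>UNIV - {bot}. \<mu> bot y \<le> (INF x\<in>{x. x < y'}. \<mu> x y')"
      by (intro bexI[of _ y'] INF_greatest) (auto intro: order_trans)
  qed
  show "mu_B_star \<mu> \<le> mu_max_top \<mu>"
    unfolding mu_B_star_def mu_max_top_def
    \<comment> \<open>For the same \<open>y\<close>, the choice \<open>x = bot\<close> is admissible
      in the infimum.\<close>
    by (rule SUP_mono) (auto simp: bot.not_eq_extremum intro!: bexI INF_lower)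
qed

lemma mu_A_top:
  fixes \<mu> :: "'a::{order_bot, order_top} \<Rightarrow> 'a \<Rightarrow> 's::complete_lattice"
  shows "mu_A \<mu> top = mu_A_star \<mu>"
proof -
  have "{a. a < top} = UNIV - {top :: 'a}"
    by (auto simp: less_le)
  then show ?thesis unfolding mu_A_def mu_A_star_def by simp
qed

text \<open>Since \<open>bot\<close> and \<open>top\<close> differ, \<open>\<mu> bot top\<close> is
  one of the values in both extrema, so each equation only says that it bounds all the others. The
  slope condition on \<open>bot < x < top\<close> translates one bound into the other.\<close>

lemma mu_max_top_eq_iff_mu_min_top_eq:
  fixes \<mu> :: "'a::{order_bot, order_top} \<Rightarrow> 'a \<Rightarrow> 's::complete_lattice"
  assumes "(bot :: 'a) \<noteq> top" and slope: "slope_like \<mu>"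
  shows "mu_max_top \<mu> = \<mu> bot top \<longleftrightarrow> mu_min_top \<mu> = \<mu> bot top"
proof -
  have "mu_max_top \<mu> = \<mu> bot top \<longleftrightarrow> (\<forall>x. x \<noteq> bot \<longrightarrow> \<mu> bot x \<le> \<mu> bot top)"
    unfolding mu_max_top_def using assms(1)
    by (auto simp: order.eq_iff SUP_le_iff intro: SUP_upper)
  moreover have "mu_min_top \<mu> = \<mu> bot top \<longleftrightarrow> (\<forall>x. x \<noteq> top \<longrightarrow> \<mu> bot top \<le> \<mu> x top)"
    unfolding mu_min_top_def using assms(1)
    by (auto simp: order.eq_iff le_INF_iff intro: INF_lower)
  moreover have "\<mu> bot x \<le> \<mu> bot top \<longleftrightarrow> \<mu> bot top \<le> \<mu> x top" if "x \<noteq> bot" "x \<noteq> top" for x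
    using slope_like_le_iff[OF slope, of bot x top] that
    by (simp add: bot.not_eq_extremum top.not_eq_extremum)
  \<comment> \<open>The cases left out above, \<open>x = top\<close> on the first side and
    \<open>x = bot\<close> on the second, hold by reflexivity.\<close>
  ultimately show ?thesis by (metis order_refl)
qed

text \<open>Semi-stability is only used at the stopping points \<open>y'\<close>, where
  \<open>\<mu> bot y'\<close> is a lower bound for \<open>mu_A \<mu> y'\<close>.\<close>

lemma mu_max_top_le_if_semi_stable:
  fixes \<mu> :: "'a::{order_bot, order_top} \<Rightarrow> 'a \<Rightarrow> 's::complete_lattice"
  assumes desc: "\<And>x :: nat \<Rightarrow> 'a. (\<And>n. x n > x (Suc n)) \<Longrightarrow>
        \<exists>N. \<mu> bot (x N) \<le> \<mu> (x (Suc N)) (x N)"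
    and total: "\<And>s t :: 's. s \<le> t \<or> t \<le> s"
    and slope: "slope_like \<mu>"
    and "semi_stable \<mu>"
  shows "mu_max_top \<mu> \<le> mu_A \<mu> top"
  unfolding mu_max_top_def
proof (rule SUP_least)
  fix y :: 'a assume "y \<in> UNIV - {bot}"
  then obtain y' where y': "y' \<noteq> bot" "\<mu> bot y \<le> \<mu> bot y'" "\<And>x. x < y' \<Longrightarrow> \<mu> bot y' \<le> \<mu> x y'"
    using exists_below_minimizing_at_bot[OF desc total slope] by blast
  note y'(2)
  also have "\<mu> bot y' \<le> mu_A \<mu> y'"
    \<comment> \<open>For each \<open>a < y'\<close> the supremum is bounded below by its term at
      \<open>b = y'\<close>.\<close>
    unfolding mu_A_def by (rule INF_greatest) (auto intro: SUP_upper2 y'(3))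
  also have "\<dots> \<le> mu_A \<mu> top"
    using \<open>semi_stable \<mu>\<close> y'(1) total less_le_not_le unfolding semi_stable_def by blast
  finally show "\<mu> bot y \<le> mu_A \<mu> top" .
qed

text \<open>The term \<open>a = bot\<close> of the infimum is a supremum over part of the index set
  of \<open>mu_max_top\<close>.\<close>

lemma mu_A_le_mu_max_top:
  assumes "y \<noteq> bot"
  shows "mu_A \<mu> y \<le> mu_max_top \<mu>"
proof -
  have "mu_A \<mu> y \<le> (SUP b \<in> {b. bot < b \<and> b \<le> y}. \<mu> bot b)"
    unfolding mu_A_def using assms by (intro INF_lower) (simp add: bot.not_eq_extremum)
  also have "\<dots> \<le> mu_max_top \<mu>"
    unfolding mu_max_top_def by (rule SUP_subset_mono) auto
  finally show ?thesis .
qed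

theorem theorem1p3:
  fixes \<mu> :: "'a::{order_bot, order_top} \<Rightarrow> 'a \<Rightarrow> 's::complete_lattice"
  assumes bounded: "(bot :: 'a) \<noteq> top"
    and asc: "\<And>x :: nat \<Rightarrow> 'a. (\<And>n. x n < x (Suc n)) \<Longrightarrow>
        \<exists>N. \<mu> (x N) (x (Suc N)) \<le> \<mu> (x N) top"
    and desc: "\<And>x :: nat \<Rightarrow> 'a. (\<And>n. x n > x (Suc n)) \<Longrightarrow>
        \<exists>N. \<mu> bot (x N) \<le> \<mu> (x (Suc N)) (x N)"
    and total: "\<And>s t :: 's. s \<le> t \<or> t \<le> s"
    and slope: "slope_like \<mu>"
  shows "(mu_max_top \<mu> = \<mu> bot top \<longleftrightarrow> mu_min_top \<mu> = \<mu> bot top) \<and>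
         (mu_min_top \<mu> = \<mu> bot top \<longleftrightarrow> mu_min_top \<mu> = mu_max_top \<mu>) \<and>
         (mu_min_top \<mu> = mu_max_top \<mu> \<longleftrightarrow> nash_equilibrium \<mu>) \<and>
         (nash_equilibrium \<mu> \<longleftrightarrow> semi_stable \<mu>)"
proof -
  have min_le: "mu_min_top \<mu> \<le> \<mu> bot top" and le_max: "\<mu> bot top \<le> mu_max_top \<mu>"
    unfolding mu_min_top_def mu_max_top_def using bounded
    by (auto intro: INF_lower SUP_upper)
  note ab = mu_max_top_eq_iff_mu_min_top_eq[OF bounded slope]
  have bc: "mu_min_top \<mu> = \<mu> bot top \<longleftrightarrow> mu_min_top \<mu> = mu_max_top \<mu>"
    \<comment> \<open>From left to right, \<open>ab\<close> makes both extrema equal to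
      \<open>\<mu> bot top\<close>; conversely, \<open>\<mu> bot top\<close> is squeezed between two
      equal extrema.\<close>
    using ab min_le le_max by (metis order.antisym)
  have A: "mu_A_star \<mu> = mu_min_top \<mu>"
    using asc total slope by (rule mu_A_star_eq_mu_min_top)
  have B: "mu_B_star \<mu> = mu_max_top \<mu>"
    using desc total slope by (rule mu_B_star_eq_mu_max_top)
  have cd: "mu_min_top \<mu> = mu_max_top \<mu> \<longleftrightarrow> nash_equilibrium \<mu>"
    by (simp add: nash_equilibrium_def A B)
  have "mu_min_top \<mu> = mu_max_top \<mu> \<longleftrightarrow> semi_stable \<mu>"
  proof
    assume "mu_min_top \<mu> = mu_max_top \<mu>"
    then show "semi_stable \<mu>"
      \<comment> \<open>Here \<open>mu_A \<mu> top\<close> has become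
        \<open>mu_min_top \<mu>\<close>, which by assumption is the upper bound
        \<open>mu_max_top \<mu>\<close> of all \<open>mu_A \<mu> y\<close>.\<close>
      unfolding semi_stable_def mu_A_top A using mu_A_le_mu_max_top[of _ \<mu>]
      by (auto simp: less_le_not_le)
  next
    assume "semi_stable \<mu>"
    then have "mu_max_top \<mu> \<le> mu_min_top \<mu>"
      using mu_max_top_le_if_semi_stable[OF desc total slope] unfolding mu_A_top A by simp
    then show "mu_min_top \<mu> = mu_max_top \<mu>"
      using min_le le_max by (meson order.antisym order_trans)
  qed
  with ab bc cd show ?thesis by simp
qed

end
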